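(* For $\gamma\in\mathbb Z$ put $$S_\gamma(q):=\sum_{\substack{\alpha,\beta\in\mathbb Z\\ \alpha+2\beta=\gamma}}(-1)^\beta\sum_{k_1=|\alpha|}^\infty\binom{2k_1}{k_1+\alpha}A_{k_1}(q)\sum_{k_2=|\beta|}^\infty\binom{2k_2}{k_2+\beta}A_{k_2}(q).$$ Then for every integer $n$, $$\frac{1}{R_{1,4}(q)F_5(q)}=q^{-\frac{5n^2-n}{2}}\big\{S_{5n+1}(q)+S_{5n}(q)-S_{5n-1}(q)-S_{5n-2}(q)\big\}$$ and $$\frac{1}{R_{2,3}(q)F_5(q)}=q^{-\frac{5n^2-3n}{2}}\big\{S_{5n}(q)+S_{5n-1}(q)-S_{5n-2}(q)-S_{5n-3}(q)\big\}.$$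
   Context: Here $(a;q)_\infty:=\prod_{j=0}^\infty(1-aq^j)$ for $|q|<1$. Identities may be read as identities of formal Laurent series in $q$ (equivalently, for $0<|q|<1$). For integers $k\ge0$, $$A_k(q):=\sum_{0<t_1<t_2<\cdots<t_k}\frac{q^{t_1+\cdots+t_k}}{(1-q^{t_1})^2\cdots(1-q^{t_k})^2},\qquad A_0(q)=1.$$ The Rogers–Ramanujan functions and $F_5$ are $$R_{1,4}(q):=\prod_{n=0}^\infty\frac{1}{(1-q^{5n+1})(1-q^{5n+4})},\qquad R_{2,3}(q):=\prod_{n=0}^\infty\frac{1}{(1-q^{5n+2})(1-q^{5n+3})},\qquad F_5(q):=\frac{(q;q)_\infty^6}{(q^5;q^5)_\infty}.$$ *)

theory Defs
  imports "HOL-Analysis.Analysis"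
begin

definition qpoch_inf :: "complex \<Rightarrow> complex \<Rightarrow> complex" where
  "qpoch_inf a q = (\<Prod>j. 1 - a * q ^ j)"

definition R14 :: "complex \<Rightarrow> complex" where
  "R14 q = (\<Prod>n. 1 / ((1 - q ^ (5 * n + 1)) * (1 - q ^ (5 * n + 4))))"

definition R23 :: "complex \<Rightarrow> complex" where
  "R23 q = (\<Prod>n. 1 / ((1 - q ^ (5 * n + 2)) * (1 - q ^ (5 * n + 3))))"

definition F5 :: "complex \<Rightarrow> complex" where
  "F5 q = qpoch_inf q q ^ 6 / qpoch_inf (q ^ 5) (q ^ 5)"

text \<open>The tuples \<open>0 < t\<^sub>1 < \<dots> < t\<^sub>k\<close>, as lists.\<close>

definition incr_tuples :: "nat \<Rightarrow> nat list set" where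
  "incr_tuples k = {ts. length ts = k \<and> sorted_wrt (<) ts \<and> (\<forall>t\<in>set ts. 0 < t)}"

definition A :: "nat \<Rightarrow> complex \<Rightarrow> complex" where
  "A k q = (\<Sum>\<^sub>\<infinity>ts\<in>incr_tuples k. q ^ sum_list ts / (\<Prod>t\<leftarrow>ts. (1 - q ^ t)\<^sup>2))"

definition binom_A_sum :: "int \<Rightarrow> complex \<Rightarrow> complex" where
  "binom_A_sum \<alpha> q =
     (\<Sum>\<^sub>\<infinity>k\<in>{nat \<bar>\<alpha>\<bar>..}. of_nat ((2 * k) choose nat (int k + \<alpha>)) * A k q)"

definition S :: "int \<Rightarrow> complex \<Rightarrow> complex" where
  "S \<gamma> q = (\<Sum>\<^sub>\<infinity>(\<alpha>, \<beta>)\<in>{(\<alpha>, \<beta>). \<alpha> + 2 * \<beta> = \<gamma>}.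
     (-1) powi \<beta> * binom_A_sum \<alpha> q * binom_A_sum \<beta> q)"

text \<open>
  \<open>prodinf\<close> and \<open>infsum\<close> are total, with default values where there is no convergence.
  The lemmas below show that for \<open>norm q < 1\<close> every product and sum used above converges,
  the sums absolutely, and that \<open>R14 q\<close>, \<open>R23 q\<close> and \<open>F5 q\<close> are nonzero.
\<close>

lemma A_0: "A 0 q = 1"
proof -
  have "incr_tuples 0 = {[]}"
    by (auto simp: incr_tuples_def)
  thus ?thesis
    by (simp add: A_def)
qed

lemma one_minus_power_nz:
  fixes q :: complex
  assumes "norm q < 1" "n > 0"
  shows "1 - q ^ n \<noteq> 0"
proof
  assume "1 - q ^ n = 0"
  hence "norm q ^ n = 1"
    by (metis eq_iff_diff_eq_0 norm_one norm_power)
  moreover have "norm q ^ n < 1"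
    using assms by (simp add: power_less_one_iff)
  ultimately show False by simp
qed

lemma convergent_prod_qpoch_inf:
  fixes a q :: complex
  assumes "norm q < 1"
  shows "convergent_prod (\<lambda>j. 1 - a * q ^ j)"
proof -
  have "summable (\<lambda>j. norm a * norm q ^ j)"
    using assms by (intro summable_mult summable_geometric) auto
  hence "summable (\<lambda>j. norm ((1 - a * q ^ j) - 1))"
    by (simp add: norm_mult norm_power)
  thus ?thesis
    by (intro abs_convergent_prod_imp_convergent_prod summable_imp_abs_convergent_prod)
qed

lemma convergent_prod_residue_pair:
  fixes q :: complex
  assumes "norm q < 1" "a > 0" "b > 0"
  shows "convergent_prod (\<lambda>n. 1 / ((1 - q ^ (5 * n + a)) * (1 - q ^ (5 * n + b))))"
proof -
  have q5: "norm (q ^ 5) < 1"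
    using assms by (simp add: norm_power power_less_one_iff)
  have *: "convergent_prod (\<lambda>n. 1 - q ^ (5 * n + c))" for c
    using convergent_prod_qpoch_inf[OF q5, of "q ^ c"]
    by (simp add: mult.commute add.commute flip: power_add power_mult)
  have "convergent_prod (\<lambda>n. inverse ((1 - q ^ (5 * n + a)) * (1 - q ^ (5 * n + b))))"
    by (intro convergent_prod_inverse convergent_prod_mult *)
  thus ?thesis
    by (simp add: field_simps)
qed

lemma qpoch_inf_power_nz:
  assumes "norm q < 1" "m > 0"
  shows "qpoch_inf (q ^ m) (q ^ m) \<noteq> 0"
proof -
  have "norm (q ^ m) < 1"
    using assms by (simp add: norm_power power_less_one_iff)
  moreover have "1 - q ^ m * (q ^ m) ^ j \<noteq> 0" for j
    using one_minus_power_nz[OF assms(1), of "m + m * j"] assms(2)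
    by (simp add: power_add power_mult)
  ultimately show ?thesis
    unfolding qpoch_inf_def by (intro prodinf_nonzero convergent_prod_qpoch_inf)
qed

lemma R14_R23_F5_nz:
  assumes "norm q < 1"
  shows "R14 q \<noteq> 0" "R23 q \<noteq> 0" "F5 q \<noteq> 0"
proof -
  have *: "(\<Prod>n. 1 / ((1 - q ^ (5 * n + a)) * (1 - q ^ (5 * n + b)))) \<noteq> 0"
    if "a > 0" "b > 0" for a b
  proof (rule prodinf_nonzero)
    show "1 / ((1 - q ^ (5 * n + a)) * (1 - q ^ (5 * n + b))) \<noteq> 0" for n
      using that one_minus_power_nz[OF assms, of "5 * n + a"]
        one_minus_power_nz[OF assms, of "5 * n + b"] by simp
  qed (use that assms in \<open>intro convergent_prod_residue_pair\<close>)
  show "R14 q \<noteq> 0" "R23 q \<noteq> 0"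
    unfolding R14_def R23_def by (rule *; simp)+
  show "F5 q \<noteq> 0"
    using qpoch_inf_power_nz[OF assms, of 1] qpoch_inf_power_nz[OF assms, of 5]
    by (simp add: F5_def)
qed

lemma norm_A_summand:
  fixes q :: complex
  shows "norm (q ^ sum_list ts / (\<Prod>t\<leftarrow>ts. (1 - q ^ t)\<^sup>2)) =
    (\<Prod>t\<leftarrow>ts. norm (q ^ t / (1 - q ^ t)\<^sup>2))"
proof (induction ts)
  case (Cons a ts)
  have "q ^ sum_list (a # ts) / (\<Prod>t\<leftarrow>a # ts. (1 - q ^ t)\<^sup>2) =
      (q ^ a / (1 - q ^ a)\<^sup>2) * (q ^ sum_list ts / (\<Prod>t\<leftarrow>ts. (1 - q ^ t)\<^sup>2))"
    by (simp add: power_add)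
  thus ?case
    by (simp only: norm_mult Cons.IH list.map prod_list.Cons)
qed auto

lemma A_summand_bound:
  fixes q :: complex
  assumes "norm q < 1"
  obtains M where "\<And>k F. finite F \<Longrightarrow> F \<subseteq> incr_tuples k \<Longrightarrow>
    (\<Sum>ts\<in>F. norm (q ^ sum_list ts / (\<Prod>t\<leftarrow>ts. (1 - q ^ t)\<^sup>2))) \<le> M / 16 ^ k"
proof
  define r where "r = norm q"
  have r: "0 \<le> r" "r < 1"
    using assms by (auto simp: r_def)
  define x where "x t = norm (q ^ t / (1 - q ^ t)\<^sup>2)" for t
  have x_nonneg: "x t \<ge> 0" for t
    by (simp add: x_def)
  have x_le: "x t \<le> r ^ t / (1 - r)\<^sup>2" for t
  proof (cases "t = 0")
    case True
    thus ?thesis by (simp add: x_def)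
  next
    case False
    hence "r ^ t \<le> r ^ 1"
      using r by (intro power_decreasing) auto
    moreover have "1 - r ^ t \<le> norm (1 - q ^ t)"
      by (metis norm_one norm_power norm_triangle_ineq2 r_def)
    ultimately have "1 - r \<le> norm (1 - q ^ t)"
      by simp
    hence "(1 - r)\<^sup>2 \<le> norm (1 - q ^ t) ^ 2"
      using r by (intro power_mono) auto
    thus ?thesis
      unfolding x_def norm_divide norm_power r_def[symmetric]
      using r by (intro divide_left_mono mult_pos_pos) (auto intro: order_less_le_trans[of 0 "(1 - r)\<^sup>2"])
  qed
  have sm: "summable (\<lambda>t. 16 * (r ^ t / (1 - r)\<^sup>2))"
    using r by (intro summable_mult summable_divide summable_geometric) auto
  define C where "C = (\<Sum>t. 16 * (r ^ t / (1 - r)\<^sup>2))"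
  fix k F
  assume F: "finite F" "F \<subseteq> incr_tuples k"
  define U where "U = \<Union> (set ` F)"
  have "finite U"
    using F by (auto simp: U_def)
  have inj: "inj_on set F"
    using F unfolding inj_on_def incr_tuples_def by (auto intro: strict_sorted_equal)
  have "16 ^ k * (\<Sum>ts\<in>F. norm (q ^ sum_list ts / (\<Prod>t\<leftarrow>ts. (1 - q ^ t)\<^sup>2))) =
      (\<Sum>ts\<in>F. \<Prod>t\<in>set ts. 16 * x t)"
    unfolding sum_distrib_left
  proof (rule sum.cong)
    fix ts assume "ts \<in> F"
    hence ts: "length ts = k" "sorted_wrt (<) ts"
      using F by (auto simp: incr_tuples_def)
    hence "distinct ts"
      by (simp add: strict_sorted_iff)
    hence "(\<Prod>t\<in>set ts. 16 * x t) = (\<Prod>t\<leftarrow>ts. 16 * x t)"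
      by (rule prod.distinct_set_conv_list)
    also have "\<dots> = 16 ^ length ts * (\<Prod>t\<leftarrow>ts. x t)"
      by (induction ts) auto
    finally show "16 ^ k * norm (q ^ sum_list ts / (\<Prod>t\<leftarrow>ts. (1 - q ^ t)\<^sup>2)) =
        (\<Prod>t\<in>set ts. 16 * x t)"
      by (simp only: norm_A_summand x_def[abs_def] ts)
  qed auto
  also have "\<dots> = (\<Sum>T\<in>set ` F. \<Prod>t\<in>T. 16 * x t)"
    using inj by (simp add: sum.reindex)
  also have "\<dots> \<le> (\<Sum>T\<in>Pow U. \<Prod>t\<in>T. 16 * x t)"
    using \<open>finite U\<close> by (intro sum_mono2) (auto simp: U_def intro!: prod_nonneg x_nonneg)
  also have "\<dots> = (\<Prod>t\<in>U. 16 * x t + 1)"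
    using \<open>finite U\<close> by (subst prod_add) auto
  also have "\<dots> \<le> (\<Prod>t\<in>U. exp (16 * x t))"
    using exp_ge_add_one_self x_nonneg by (intro prod_mono) (auto simp: add.commute)
  also have "\<dots> = exp (\<Sum>t\<in>U. 16 * x t)"
    using \<open>finite U\<close> by (simp add: exp_sum)
  also have "(\<Sum>t\<in>U. 16 * x t) \<le> (\<Sum>t\<in>U. 16 * (r ^ t / (1 - r)\<^sup>2))"
    by (intro sum_mono mult_left_mono x_le) auto
  also have "\<dots> \<le> C"
    unfolding C_def using \<open>finite U\<close> sm r by (intro sum_le_suminf) auto
  finally show "(\<Sum>ts\<in>F. norm (q ^ sum_list ts / (\<Prod>t\<leftarrow>ts. (1 - q ^ t)\<^sup>2))) \<le> exp C / 16 ^ k"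
    by (simp add: field_simps)
qed

lemma abs_summable_A:
  fixes q :: complex
  assumes "norm q < 1"
  shows "(\<lambda>ts. norm (q ^ sum_list ts / (\<Prod>t\<leftarrow>ts. (1 - q ^ t)\<^sup>2))) summable_on incr_tuples k"
proof -
  obtain M where "\<And>k F. finite F \<Longrightarrow> F \<subseteq> incr_tuples k \<Longrightarrow>
      (\<Sum>ts\<in>F. norm (q ^ sum_list ts / (\<Prod>t\<leftarrow>ts. (1 - q ^ t)\<^sup>2))) \<le> M / 16 ^ k"
    using A_summand_bound[OF assms] by blast
  thus ?thesis
    unfolding Infinite_Sum.abs_summable_iff_bdd_above by (intro bdd_aboveI2[where M = "M / 16 ^ k"]) auto
qed

lemma norm_A_le:
  assumes "norm q < 1"
  obtains M where "M \<ge> 0" "\<And>k. norm (A k q) \<le> M / 16 ^ k"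
proof -
  obtain M where M: "\<And>k F. finite F \<Longrightarrow> F \<subseteq> incr_tuples k \<Longrightarrow>
      (\<Sum>ts\<in>F. norm (q ^ sum_list ts / (\<Prod>t\<leftarrow>ts. (1 - q ^ t)\<^sup>2))) \<le> M / 16 ^ k"
    using A_summand_bound[OF assms] by blast
  show ?thesis
  proof
    show "M \<ge> 0"
      using M[of "{}" 0] by simp
    show "norm (A k q) \<le> M / 16 ^ k" for k
      unfolding A_def using abs_summable_A[OF assms] M
      by (intro order_trans[OF norm_infsum_bound] infsum_le_finite_sums)
  qed
qed

lemma norm_binom_A_le:
  assumes "\<And>k. norm (A k q) \<le> M / 16 ^ k" "M \<ge> 0"
  shows "norm (of_nat ((2 * k) choose j) * A k q) \<le> M * (1 / 4) ^ k"
proof -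
  have "real ((2 * k) choose j) \<le> real (2 ^ (2 * k))"
    using binomial_le_pow2 of_nat_mono by blast
  also have "\<dots> = 4 ^ k"
    by (simp add: power_mult)
  finally have "norm (of_nat ((2 * k) choose j) * A k q) \<le> 4 ^ k * (M / 16 ^ k)"
    unfolding norm_mult norm_of_nat using assms by (intro mult_mono) auto
  also have "(16::real) ^ k = 4 ^ k * 4 ^ k"
    by (simp flip: power_mult_distrib)
  finally show ?thesis
    by (simp add: power_divide)
qed

lemma summable_on_quarter: "(\<lambda>k::nat. M * (1 / 4 :: real) ^ k) summable_on X"
proof -
  have "summable (\<lambda>k. norm ((1 / 4 :: real) ^ k))"
    by (simp add: summable_geometric)
  hence "(\<lambda>k. (1 / 4 :: real) ^ k) summable_on X"
    using norm_summable_imp_summable_on summable_on_subset_banach by blast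
  thus ?thesis
    by (rule summable_on_cmult_right)
qed

lemma abs_summable_binom_A_sum:
  assumes "norm q < 1"
  shows "(\<lambda>k. norm (of_nat ((2 * k) choose nat (int k + \<alpha>)) * A k q)) summable_on {nat \<bar>\<alpha>\<bar>..}"
proof -
  obtain M where "M \<ge> 0" "\<And>k. norm (A k q) \<le> M / 16 ^ k"
    using norm_A_le[OF assms] by blast
  thus ?thesis
    by (intro Infinite_Sum.abs_summable_on_comparison_test'[OF summable_on_quarter] norm_binom_A_le)
qed

lemma norm_binom_A_sum_le:
  assumes "norm q < 1"
  obtains M where "M \<ge> 0" "\<And>\<alpha>. norm (binom_A_sum \<alpha> q) \<le> M * (1 / 2) ^ nat \<bar>\<alpha>\<bar>"
proof -
  obtain M where M: "M \<ge> 0" "\<And>k. norm (A k q) \<le> M / 16 ^ k"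
    using norm_A_le[OF assms] by blast
  define c :: real where "c = (\<Sum>\<^sub>\<infinity>k::nat. M * (1 / 2) ^ k)"
  have "summable (\<lambda>k. norm ((1 / 2 :: real) ^ k))"
    by (simp add: summable_geometric)
  hence "(\<lambda>k. (1 / 2 :: real) ^ k) summable_on X" for X
    using norm_summable_imp_summable_on summable_on_subset_banach by blast
  hence half: "(\<lambda>k::nat. M * (1 / 2 :: real) ^ k) summable_on X" for X
    by (rule summable_on_cmult_right)
  have "norm (binom_A_sum \<alpha> q) \<le> c * (1 / 2) ^ nat \<bar>\<alpha>\<bar>" for \<alpha>
  proof -
    let ?a = "nat \<bar>\<alpha>\<bar>"
    have "norm (binom_A_sum \<alpha> q) \<le>
        (\<Sum>\<^sub>\<infinity>k\<in>{?a..}. norm (of_nat ((2 * k) choose nat (int k + \<alpha>)) * A k q))"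
      unfolding binom_A_sum_def by (intro norm_infsum_bound abs_summable_binom_A_sum assms)
    also have "\<dots> \<le> (\<Sum>\<^sub>\<infinity>k\<in>{?a..}. M * (1 / 2) ^ k * (1 / 2) ^ ?a)"
    proof (intro infsum_mono abs_summable_binom_A_sum assms summable_on_cmult_left half)
      fix k assume k: "k \<in> {?a..}"
      have "norm (of_nat ((2 * k) choose nat (int k + \<alpha>)) * A k q) \<le> M * (1 / 4) ^ k"
        using M by (intro norm_binom_A_le)
      also have "(1 / 4 :: real) ^ k = (1 / 2) ^ k * (1 / 2) ^ k"
        by (simp flip: power_mult_distrib)
      also have "M * \<dots> \<le> M * ((1 / 2) ^ k * (1 / 2) ^ ?a)"
        using k M by (intro mult_left_mono power_decreasing) auto
      finally show "norm (of_nat ((2 * k) choose nat (int k + \<alpha>)) * A k q) \<le>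
          M * (1 / 2) ^ k * (1 / 2) ^ ?a"
        by (simp add: mult.assoc)
    qed
    also have "\<dots> = (\<Sum>\<^sub>\<infinity>k\<in>{?a..}. M * (1 / 2) ^ k) * (1 / 2) ^ ?a"
      by (intro infsum_cmult_left half)
    also have "\<dots> \<le> c * (1 / 2) ^ ?a"
      unfolding c_def using M by (intro mult_right_mono infsum_mono_neutral half) auto
    finally show ?thesis .
  qed
  moreover have "c \<ge> 0"
    unfolding c_def using M by (intro infsum_nonneg) auto
  ultimately show ?thesis
    using that by blast
qed

lemma abs_summable_S:
  assumes "norm q < 1"
  shows "(\<lambda>(\<alpha>, \<beta>). norm ((-1) powi \<beta> * binom_A_sum \<alpha> q * binom_A_sum \<beta> q))
    summable_on {(\<alpha>, \<beta>). \<alpha> + 2 * \<beta> = \<gamma>}"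
proof -
  obtain M where M: "M \<ge> 0" "\<And>\<alpha>. norm (binom_A_sum \<alpha> q) \<le> M * (1 / 2) ^ nat \<bar>\<alpha>\<bar>"
    using norm_binom_A_sum_le[OF assms] by blast
  have half: "(\<lambda>k::nat. (1 / 2 :: real) ^ k) summable_on UNIV"
    by (intro norm_summable_imp_summable_on) (simp add: summable_geometric)
  have "(\<lambda>\<beta>::int. (1 / 2 :: real) ^ nat \<bar>\<beta>\<bar>) summable_on ({0..} \<union> {..0})"
  proof (rule summable_on_union)
    show "(\<lambda>\<beta>::int. (1 / 2 :: real) ^ nat \<bar>\<beta>\<bar>) summable_on {0..}"
      using half
      by (subst summable_on_reindex_bij_witness[of _ int nat UNIV "\<lambda>k. (1 / 2) ^ k"]) auto
    show "(\<lambda>\<beta>::int. (1 / 2 :: real) ^ nat \<bar>\<beta>\<bar>) summable_on {..0}"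
      using half
      by (subst summable_on_reindex_bij_witness[of _ "\<lambda>k. - int k" "\<lambda>\<beta>. nat (- \<beta>)" UNIV
            "\<lambda>k. (1 / 2) ^ k"]) auto
  qed
  also have "{0..} \<union> {..0} = (UNIV :: int set)"
    by auto
  finally have int: "(\<lambda>\<beta>::int. M * M * (1 / 2 :: real) ^ nat \<bar>\<beta>\<bar>) summable_on UNIV"
    by (rule summable_on_cmult_right)
  hence "(\<lambda>(\<alpha>, \<beta>). M * M * (1 / 2 :: real) ^ nat \<bar>\<beta>\<bar>) summable_on {(\<alpha>, \<beta>). \<alpha> + 2 * \<beta> = \<gamma>}"
    by (subst summable_on_reindex_bij_witness[of _ "\<lambda>\<beta>. (\<gamma> - 2 * \<beta>, \<beta>)" snd UNIV
          "\<lambda>\<beta>. M * M * (1 / 2) ^ nat \<bar>\<beta>\<bar>"]) auto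
  hence "(\<lambda>p. norm (case p of (\<alpha>, \<beta>) \<Rightarrow> (-1) powi \<beta> * binom_A_sum \<alpha> q * binom_A_sum \<beta> q))
    summable_on {(\<alpha>, \<beta>). \<alpha> + 2 * \<beta> = \<gamma>}"
  proof (rule Infinite_Sum.abs_summable_on_comparison_test')
    fix p :: "int \<times> int"
    obtain \<alpha> \<beta> where p: "p = (\<alpha>, \<beta>)" by force
    have "norm (binom_A_sum \<alpha> q) \<le> M * 1"
      using M(1) by (intro order_trans[OF M(2)] mult_left_mono power_le_one) auto
    hence "norm (binom_A_sum \<alpha> q) * norm (binom_A_sum \<beta> q) \<le> M * (M * (1 / 2) ^ nat \<bar>\<beta>\<bar>)"
      using M by (intro mult_mono) auto
    thus "norm (case p of (\<alpha>, \<beta>) \<Rightarrow> (-1) powi \<beta> * binom_A_sum \<alpha> q * binom_A_sum \<beta> q)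
        \<le> (case p of (\<alpha>, \<beta>) \<Rightarrow> M * M * (1 / 2) ^ nat \<bar>\<beta>\<bar>)"
      by (simp add: p norm_mult norm_power_int mult.assoc)
  qed
  thus ?thesis
    by (simp add: case_prod_unfold)
qed

end

theory Submission
  imports Defs
begin

text \<open>
  Since \<open>\<Sum>\<^sub>\<alpha> (2k choose k+\<alpha>) z^\<alpha> = (z + 2 + 1/z)^k\<close>, the inner sums \<open>B\<^sub>\<alpha>\<close> = \<open>binom_A_sum \<alpha> q\<close> are the
  Laurent coefficients in \<open>z\<close> of \<open>\<Prod>\<^sub>t (1 + z q^t) (1 + q^t/z) / (1 - q^t)\<^sup>2\<close>. Multiplication by \<open>1 + z\<close> turns
  this into a Jacobi theta series, so \<open>B\<^sub>\<alpha> + B\<^sub>\<alpha>\<^sub>-\<^sub>1 = q^(\<alpha>(\<alpha>-1)/2) / (q;q)\<^sub>\<infinity>^3\<close>. No uniqueness of Laurent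
  coefficients is needed: when the \<open>t\<^sub>i\<close> are restricted to \<open>1..N\<close>, both sides satisfy the same
  three-term recurrence in \<open>N\<close>, and the same recurrence gives the finite Jacobi triple product.
  The factor \<open>(1 + z)(1 - z\<^sup>2) = 1 + z - z\<^sup>2 - z\<^sup>3\<close> then explains the combination of four values of \<open>S\<close>: it
  equals \<open>(q;q)\<^sub>\<infinity>^-6 \<Sum>\<^sub>\<beta> (-1)^\<beta> q^(\<alpha>(\<alpha>-1)/2 + \<beta>(\<beta>-1)/2)\<close> with \<open>\<alpha> = \<gamma> - 2\<beta>\<close>. Completing the square by
  \<open>\<beta> = c + 2n\<close> leaves a theta series in \<open>q^5\<close>, which the triple product evaluates.
\<close>

section \<open>q-factorials, theta coefficients and truncated sums\<close>

definition qfact :: "complex \<Rightarrow> nat \<Rightarrow> complex" where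
  "qfact q n = (\<Prod>t<n. 1 - q ^ Suc t)"

text \<open>The value 0 at negative arguments makes \<open>jtp_coeff q N \<alpha>\<close> vanish
  outside -N \<le> \<alpha> \<le> N + 1 and spares its recurrences any boundary cases.\<close>

definition inv_qfact :: "complex \<Rightarrow> int \<Rightarrow> complex" where
  "inv_qfact q j = (if j < 0 then 0 else inverse (qfact q (nat j)))"

text \<open>The division is exact, since one of two consecutive integers is even.\<close>

definition theta_coeff :: "complex \<Rightarrow> int \<Rightarrow> complex" where
  "theta_coeff q \<alpha> = q powi (\<alpha> * (\<alpha> - 1) div 2)"

text \<open>The Gaussian binomial coefficient \<open>[2N+1, N+\<alpha>]\<close> times \<open>q^(\<alpha>(\<alpha>-1)/2)\<close>.\<close>

definition jtp_coeff :: "complex \<Rightarrow> nat \<Rightarrow> int \<Rightarrow> complex" where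
  "jtp_coeff q N \<alpha> =
     qfact q (2 * N + 1) * inv_qfact q (int N + \<alpha>) * inv_qfact q (int N + 1 - \<alpha>) * theta_coeff q \<alpha>"

text \<open>With an integer lower index, Pascal's rule holds everywhere, and the coefficient at k +
  \<alpha> in row 2k is 0 whenever |\<alpha>| > k. Sums over k \<ge> |\<alpha>| thus become sums
  over all k.\<close>

definition ibinom :: "nat \<Rightarrow> int \<Rightarrow> nat" where
  "ibinom m j = (if j < 0 then 0 else m choose nat j)"

text \<open>The summand of \<open>A k q\<close>, indexed by the set of the t_i instead of the
  increasing list.\<close>

definition weight :: "complex \<Rightarrow> nat set \<Rightarrow> complex" where
  "weight q T = (\<Prod>t\<in>T. q ^ t / (1 - q ^ t)\<^sup>2)"

text \<open>Taking k = \<open>card T\<close> treats all k at once. This is the coefficient of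
  z^\<alpha> in the product over t \<le> N of 1 + x_t (z + 2 + 1/z), where x_t = q^t / (1 -
  q^t)^2.\<close>

definition binom_A_partial :: "complex \<Rightarrow> nat \<Rightarrow> int \<Rightarrow> complex" where
  "binom_A_partial q N \<alpha> =
     (\<Sum>T\<in>Pow {1..N}. of_nat (ibinom (2 * card T) (int (card T) + \<alpha>)) * weight q T)"

section \<open>Limits of q-factorials and the recurrence of the Gaussian coefficients\<close>

lemma qfact_nz: "norm q < 1 \<Longrightarrow> qfact q n \<noteq> 0"
  unfolding qfact_def using one_minus_power_nz by (auto simp del: power_Suc)

lemma qfact_tendsto:
  assumes "norm q < 1"
  shows "qfact q \<longlonglongrightarrow> qpoch_inf q q"
proof -
  have "(\<lambda>n. \<Prod>t\<le>n. 1 - q * q ^ t) \<longlonglongrightarrow> qpoch_inf q q"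
    unfolding qpoch_inf_def by (intro convergent_prod_LIMSEQ convergent_prod_qpoch_inf assms)
  then show ?thesis
    unfolding LIMSEQ_lessThan_iff_atMost[symmetric] by (simp add: qfact_def[abs_def])
qed

lemma qpoch_inf_nz: "norm q < 1 \<Longrightarrow> qpoch_inf q q \<noteq> 0"
  using qpoch_inf_power_nz[of q 1] by simp

text \<open>The convention at negative arguments fits: for j = 0 the factor 1 - q^0 vanishes, and
  for j < 0 both sides are 0.\<close>

lemma inv_qfact_rec:
  assumes "norm q < 1" "q \<noteq> 0"
  shows "inv_qfact q (j - 1) = (1 - q powi j) * inv_qfact q j"
proof (cases "j \<le> 0")
  case False
  define n where "n = nat (j - 1)"
  have j: "j = int (Suc n)"
    using False by (simp add: n_def)
  have "qfact q (Suc n) = (1 - q ^ Suc n) * qfact q n"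
    by (simp add: qfact_def)
  then show ?thesis
    using one_minus_power_nz[OF assms(1), of "Suc n"]
    unfolding j power_int_of_nat by (simp add: inv_qfact_def field_simps qfact_nz[OF assms(1)] nat_add_distrib)
qed (auto simp: inv_qfact_def)

lemma theta_coeff_Suc:
  assumes "q \<noteq> 0"
  shows "theta_coeff q (\<alpha> + 1) = theta_coeff q \<alpha> * q powi \<alpha>"
proof -
  have "(\<alpha> + 1) * (\<alpha> + 1 - 1) div 2 = (\<alpha> * (\<alpha> - 1) + 2 * \<alpha>) div 2"
    by (simp add: algebra_simps)
  also have "\<dots> = \<alpha> * (\<alpha> - 1) div 2 + \<alpha>"
    by simp
  finally show ?thesis
    using assms by (simp add: theta_coeff_def power_int_add)
qed

lemma theta_coeff_pred:
  assumes "q \<noteq> 0"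
  shows "theta_coeff q (\<alpha> - 1) = theta_coeff q \<alpha> * q powi (1 - \<alpha>)"
  using theta_coeff_Suc[OF assms, of "\<alpha> - 1"] assms
  by (simp add: mult.assoc flip: power_int_add)

text \<open>In terms of \<open>u = q^(N+1+\<alpha>)\<close> and \<open>v = q^(N+2-\<alpha>)\<close> this becomes a polynomial identity in
  \<open>u\<close>, \<open>v\<close> and \<open>1/q\<close>.\<close>

lemma jtp_coeff_Suc:
  assumes "norm q < 1" "q \<noteq> 0"
  shows "jtp_coeff q (Suc N) \<alpha> = (1 + q ^ (2 * Suc N)) * jtp_coeff q N \<alpha> +
    q ^ Suc N * (jtp_coeff q N (\<alpha> + 1) + jtp_coeff q N (\<alpha> - 1))"
proof -
  define u v X Y where "u = q powi (int N + 1 + \<alpha>)" and "v = q powi (int N + 2 - \<alpha>)"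
    and "X = inv_qfact q (int N + 1 + \<alpha>)" and "Y = inv_qfact q (int N + 2 - \<alpha>)"
  define C P where "C = theta_coeff q \<alpha>" and "P = qfact q (2 * N + 1)"
  note rec = inv_qfact_rec[OF assms]
  have X1: "inv_qfact q (int N + \<alpha>) = (1 - u) * X"
    using rec[of "int N + 1 + \<alpha>"] by (simp add: u_def X_def)
  have Y1: "inv_qfact q (int N + 1 - \<alpha>) = (1 - v) * Y"
    using rec[of "int N + 2 - \<alpha>"] by (simp add: v_def Y_def algebra_simps)
  have u': "q powi (int N + \<alpha>) = u / q" and v': "q powi (int N + 1 - \<alpha>) = v / q"
    using assms(2) by (auto simp: u_def v_def power_int_add power_int_diff eval_nat_numeral)
  have X2: "inv_qfact q (int N + (\<alpha> - 1)) = (1 - u / q) * ((1 - u) * X)"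
    using rec[of "int N + \<alpha>"] unfolding X1 u' by (simp add: algebra_simps)
  have Y2: "inv_qfact q (int N + 1 - (\<alpha> + 1)) = (1 - v / q) * ((1 - v) * Y)"
    using rec[of "int N + 1 - \<alpha>"] unfolding Y1 v' by (simp add: algebra_simps)
  \<comment> \<open>The two exponents add up to 2N + 3, free of \<alpha>, so the new factors 1 -
    q^(2N+2) and 1 - q^(2N+3) of the q-factorial are expressible by u v and 1/q.\<close>
  have uv: "u * v = q ^ (2 * N + 3)"
  proof -
    have "u * v = q powi ((int N + 1 + \<alpha>) + (int N + 2 - \<alpha>))"
      unfolding u_def v_def by (subst power_int_add) (use assms(2) in auto)
    also have "(int N + 1 + \<alpha>) + (int N + 2 - \<alpha>) = int (2 * N + 3)"
      by simp
    finally show ?thesis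
      by (simp only: power_int_of_nat)
  qed
  have u: "q ^ Suc N * q powi \<alpha> = u" and v: "q ^ Suc N * q powi (1 - \<alpha>) = v"
    using assms(2) by (auto simp: u_def v_def power_int_add power_int_diff eval_nat_numeral)
  have p: "q ^ (2 * Suc N) = u * v / q"
    using assms(2) by (simp add: uv eval_nat_numeral)
  have "qfact q (2 * Suc N + 1) = P * (1 - q ^ (2 * Suc N)) * (1 - q ^ (2 * N + 3))"
    by (simp add: qfact_def P_def eval_nat_numeral)
  then have Psuc: "qfact q (2 * Suc N + 1) = P * (1 - u * v / q) * (1 - u * v)"
    by (simp only: p uv)
  have L: "jtp_coeff q (Suc N) \<alpha> = P * (1 - u * v / q) * (1 - u * v) * X * Y * C"
  proof -
    have *: "int (Suc N) + \<alpha> = int N + 1 + \<alpha>" "int (Suc N) + 1 - \<alpha> = int N + 2 - \<alpha>"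
      by auto
    show ?thesis
      unfolding jtp_coeff_def Psuc X_def Y_def C_def * ..
  qed
  have R0: "jtp_coeff q N \<alpha> = P * ((1 - u) * X) * ((1 - v) * Y) * C"
    unfolding jtp_coeff_def X1 Y1 C_def P_def ..
  have R1: "q ^ Suc N * jtp_coeff q N (\<alpha> + 1) = P * X * ((1 - v / q) * ((1 - v) * Y)) * C * u"
  proof -
    have "inv_qfact q (int N + (\<alpha> + 1)) = X"
      by (simp add: X_def algebra_simps)
    then show ?thesis
      unfolding jtp_coeff_def Y2 theta_coeff_Suc[OF assms(2)] C_def P_def u[symmetric] by simp
  qed
  have R2: "q ^ Suc N * jtp_coeff q N (\<alpha> - 1) = P * ((1 - u / q) * ((1 - u) * X)) * Y * C * v"
  proof -
    have "inv_qfact q (int N + 1 - (\<alpha> - 1)) = Y"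
      by (simp add: Y_def algebra_simps)
    then show ?thesis
      unfolding jtp_coeff_def X2 theta_coeff_pred[OF assms(2)] C_def P_def v[symmetric] by simp
  qed
  have key: "(1 - u * v / q) * (1 - u * v) = (1 + u * v / q) * (1 - u) * (1 - v)
      + u * (1 - v) * (1 - v / q) + v * (1 - u) * (1 - u / q)"
    using assms(2) by (simp add: field_simps power2_eq_square)
  have "P * (1 - u * v / q) * (1 - u * v) * X * Y * C = P * X * Y * C * ((1 - u * v / q) * (1 - u * v))"
    by (simp only: mult_ac)
  also have "\<dots> = (1 + u * v / q) * (P * ((1 - u) * X) * ((1 - v) * Y) * C)
      + (P * X * ((1 - v / q) * ((1 - v) * Y)) * C * u + P * ((1 - u / q) * ((1 - u) * X)) * Y * C * v)"
    unfolding key by (simp only: distrib_left mult_ac add.assoc)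
  finally show ?thesis
    unfolding distrib_left[of "q ^ Suc N"] p L R0 R1 R2 .
qed

lemma jtp_coeff_0: "q \<noteq> 0 \<Longrightarrow> norm q < 1 \<Longrightarrow> jtp_coeff q 0 \<alpha> = (if \<alpha> = 0 \<or> \<alpha> = 1 then 1 else 0)"
  using one_minus_power_nz[of q 1] by (auto simp: jtp_coeff_def inv_qfact_def qfact_def theta_coeff_def)

text \<open>Each of the three q-factorials tends to (q;q)_inf, and the numerator cancels one of the
  two in the denominator.\<close>

lemma jtp_coeff_tendsto:
  assumes "norm q < 1"
  shows "(\<lambda>N. jtp_coeff q N \<alpha>) \<longlonglongrightarrow> theta_coeff q \<alpha> / qpoch_inf q q"
proof -
  have inv: "(\<lambda>N. inv_qfact q (int N + c)) \<longlonglongrightarrow> inverse (qpoch_inf q q)" for c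
  proof -
    have "(\<lambda>n. inverse (qfact q n)) \<longlonglongrightarrow> inverse (qpoch_inf q q)"
      by (intro tendsto_inverse qfact_tendsto qpoch_inf_nz assms)
    moreover have "filterlim (\<lambda>N. nat (int N + c)) at_top sequentially"
      unfolding filterlim_at_top eventually_sequentially
    proof
      fix Z show "\<exists>N. \<forall>n\<ge>N. Z \<le> nat (int n + c)"
        by (rule exI[of _ "Z + nat \<bar>c\<bar>"]) auto
    qed
    ultimately have "(\<lambda>N. inverse (qfact q (nat (int N + c)))) \<longlonglongrightarrow> inverse (qpoch_inf q q)"
      by (rule filterlim_compose)
    moreover have "eventually (\<lambda>N. inverse (qfact q (nat (int N + c))) = inv_qfact q (int N + c)) sequentially"
      using eventually_ge_at_top[of "nat \<bar>c\<bar>"] by eventually_elim (auto simp: inv_qfact_def)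
    ultimately show ?thesis
      by (rule Lim_transform_eventually)
  qed
  have "filterlim (\<lambda>N. 2 * N + 1 :: nat) at_top sequentially"
    by (rule filterlim_subseq) (auto simp: strict_mono_def)
  then have "(\<lambda>N. qfact q (2 * N + 1)) \<longlonglongrightarrow> qpoch_inf q q"
    by (rule filterlim_compose[OF qfact_tendsto[OF assms]])
  then have "(\<lambda>N. qfact q (2 * N + 1) * inv_qfact q (int N + \<alpha>) * inv_qfact q (int N + (1 - \<alpha>)) * theta_coeff q \<alpha>)
    \<longlonglongrightarrow> qpoch_inf q q * inverse (qpoch_inf q q) * inverse (qpoch_inf q q) * theta_coeff q \<alpha>"
    by (intro tendsto_intros inv)
  then show ?thesis
    using qpoch_inf_nz[OF assms] by (simp add: jtp_coeff_def[abs_def] field_simps)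
qed

text \<open>The sequence \<open>qfact q\<close> and its inverse converge, hence are bounded. The
  bound is uniform in N and serves as the majorant in the limit of the finite triple
  product.\<close>

lemma jtp_coeff_bound:
  assumes "norm q < 1"
  obtains K where "K \<ge> 0" "\<And>N \<alpha>. norm (jtp_coeff q N \<alpha>) \<le> K * norm (theta_coeff q \<alpha>)"
proof -
  have "Bseq (qfact q)"
    using qfact_tendsto[OF assms] by (metis Bseq_def convergentI convergent_imp_Bseq)
  then obtain K1 where K1: "K1 > 0" "\<And>n. norm (qfact q n) \<le> K1"
    unfolding Bseq_def by blast
  have "(\<lambda>n. inverse (qfact q n)) \<longlonglongrightarrow> inverse (qpoch_inf q q)"
    by (intro tendsto_inverse qfact_tendsto qpoch_inf_nz assms)
  then have "Bseq (\<lambda>n. inverse (qfact q n))"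
    by (metis convergentI convergent_imp_Bseq)
  then obtain K2 where K2: "K2 > 0" "\<And>n. norm (inverse (qfact q n)) \<le> K2"
    unfolding Bseq_def by blast
  have K2': "norm (inv_qfact q j) \<le> K2" for j
    using K2 by (simp add: inv_qfact_def less_imp_le)
  show ?thesis
  proof
    show "K1 * K2 * K2 \<ge> 0"
      using K1 K2 by simp
    show "norm (jtp_coeff q N \<alpha>) \<le> K1 * K2 * K2 * norm (theta_coeff q \<alpha>)" for N \<alpha>
      unfolding jtp_coeff_def norm_mult using K1 K2 K2'
      by (intro mult_mono) auto
  qed
qed

section \<open>Recurrence of the truncated sums\<close>

lemma ibinom_Suc: "ibinom (Suc m) j = ibinom m j + ibinom m (j - 1)"
proof (cases "j > 0")
  case True
  then have "nat j = Suc (nat (j - 1))"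
    by simp
  with True show ?thesis
    by (simp add: ibinom_def)
qed (auto simp: ibinom_def)

lemma sum_Pow_Suc:
  fixes f :: "nat set \<Rightarrow> 'a :: comm_monoid_add"
  shows "(\<Sum>T\<in>Pow {1..Suc N}. f T) = (\<Sum>T\<in>Pow {1..N}. f T + f (insert (Suc N) T))"
proof -
  have eq: "{1..Suc N} = insert (Suc N) {1..N}"
    by auto
  have "inj_on (insert (Suc N)) (Pow {1..N})"
    by (rule inj_onI) (metis PowD atLeastAtMost_iff insert_ident not_less_eq_eq order_refl subsetD)
  then show ?thesis
    unfolding eq Pow_insert by (subst sum.union_disjoint) (auto simp: sum.reindex sum.distrib)
qed

text \<open>A subset containing N + 1 has one more element, and Pascal's rule applied twice yields
  the weights 1, 2, 1. In the generating function this is multiplication by 1 + x (z + 2 +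
  1/z).\<close>

lemma binom_A_partial_Suc:
  "binom_A_partial q (Suc N) \<alpha> = binom_A_partial q N \<alpha> + q ^ Suc N / (1 - q ^ Suc N)\<^sup>2 *
    (binom_A_partial q N (\<alpha> + 1) + 2 * binom_A_partial q N \<alpha> + binom_A_partial q N (\<alpha> - 1))"
proof -
  define x where "x = q ^ Suc N / (1 - q ^ Suc N)\<^sup>2"
  define g where "g \<alpha> T = of_nat (ibinom (2 * card T) (int (card T) + \<alpha>)) * weight q T" for \<alpha> T
  have "g \<alpha> (insert (Suc N) T) = x * (g (\<alpha> + 1) T + 2 * g \<alpha> T + g (\<alpha> - 1) T)"
    if "T \<in> Pow {1..N}" for T
  proof -
    have T: "finite T" "Suc N \<notin> T"
      using that finite_subset by auto
    have "ibinom (2 * Suc (card T)) (int (Suc (card T)) + \<alpha>) =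
        ibinom (2 * card T) (int (card T) + (\<alpha> + 1)) + 2 * ibinom (2 * card T) (int (card T) + \<alpha>)
        + ibinom (2 * card T) (int (card T) + (\<alpha> - 1))"
      by (simp add: ibinom_Suc algebra_simps)
    moreover have "weight q (insert (Suc N) T) = x * weight q T"
      using T by (simp add: weight_def x_def)
    ultimately show ?thesis
      using T by (simp add: g_def algebra_simps)
  qed
  then show ?thesis
    unfolding binom_A_partial_def x_def[symmetric] g_def[symmetric] sum_Pow_Suc
    by (simp add: sum.distrib sum_distrib_left algebra_simps)
qed

text \<open>Pairing \<alpha> with \<alpha> - 1 is multiplication by 1 + z, which completes the
  numerator to 2N + 1 factors with Gaussian binomial coefficients. The induction compares
  recurrences only.\<close>

lemma binom_A_partial_pair:
  assumes "norm q < 1" "q \<noteq> 0"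
  shows "binom_A_partial q N \<alpha> + binom_A_partial q N (\<alpha> - 1) = jtp_coeff q N \<alpha> / (qfact q N)\<^sup>2"
proof (induction N arbitrary: \<alpha>)
  case 0
  have "binom_A_partial q 0 \<alpha> = (if \<alpha> = 0 then 1 else 0)" for \<alpha>
    by (auto simp: binom_A_partial_def weight_def ibinom_def)
  then show ?case
    using assms by (auto simp: jtp_coeff_0 qfact_def)
next
  case (Suc N)
  define y P where "y = q ^ Suc N" and "P = qfact q N"
  have nz: "1 - y \<noteq> 0" "P \<noteq> 0"
    using one_minus_power_nz[OF assms(1), of "Suc N"] qfact_nz[OF assms(1)] by (auto simp: y_def P_def)
  have P: "qfact q (Suc N) = P * (1 - y)"
    by (simp add: qfact_def P_def y_def)
  have y2: "q ^ (2 * Suc N) = y\<^sup>2"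
    unfolding y_def by (metis mult.commute power_mult)
  define c where "c = y / (1 - y)\<^sup>2"
  let ?b = "binom_A_partial q N" and ?d = "jtp_coeff q N"
  have "binom_A_partial q (Suc N) \<alpha> + binom_A_partial q (Suc N) (\<alpha> - 1) =
      (?b \<alpha> + ?b (\<alpha> - 1)) + c *
      ((?b (\<alpha> + 1) + ?b \<alpha>) + 2 * (?b \<alpha> + ?b (\<alpha> - 1)) + (?b (\<alpha> - 1) + ?b (\<alpha> - 1 - 1)))"
    unfolding binom_A_partial_Suc y_def[symmetric] c_def[symmetric] by (simp add: algebra_simps)
  also have "\<dots> = ?d \<alpha> / P\<^sup>2 + c * (?d (\<alpha> + 1) / P\<^sup>2 + 2 * (?d \<alpha> / P\<^sup>2) + ?d (\<alpha> - 1) / P\<^sup>2)"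
    using Suc.IH[of "\<alpha> + 1"] Suc.IH[of "\<alpha> - 1"] by (simp add: Suc.IH P_def)
  \<comment> \<open>The coefficient of \<open>?d \<alpha>\<close> is 1 + 2 c, and (1 - y)^2 + 2 y =
    1 + y^2.\<close>
  also have "\<dots> = ((1 + y\<^sup>2) * ?d \<alpha> + y * (?d (\<alpha> + 1) + ?d (\<alpha> - 1))) / (P * (1 - y))\<^sup>2"
    using nz by (simp add: c_def divide_simps power_mult_distrib) (simp add: algebra_simps power2_eq_square)
  also have "\<dots> = jtp_coeff q (Suc N) \<alpha> / (qfact q (Suc N))\<^sup>2"
    unfolding jtp_coeff_Suc[OF assms] P y2 by (simp add: y_def)
  finally show ?case .
qed

section \<open>From truncated to infinite sums\<close>

text \<open>Finitely many finite sets of positive integers have a common upper bound. Hence an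
  unordered sum over all such sets may be computed along the truncations to 1..N.\<close>

lemma filterlim_Pow_atLeastAtMost:
  "filterlim (\<lambda>N. Pow {1..N}) (finite_subsets_at_top {T. finite T \<and> (0::nat) \<notin> T}) sequentially"
  unfolding filterlim_finite_subsets_at_top
proof (intro allI impI)
  fix X :: "nat set set"
  assume "finite X \<and> X \<subseteq> {T. finite T \<and> 0 \<notin> T}"
  then have X: "finite X" "\<And>T. T \<in> X \<Longrightarrow> finite T" "\<And>T. T \<in> X \<Longrightarrow> 0 \<notin> T"
    by blast+
  have "finite (\<Union> X)"
    by (intro finite_Union X)
  then obtain N0 where N0: "\<forall>t\<in>\<Union> X. t \<le> N0"
    unfolding finite_nat_set_iff_bounded_le ..
  show "\<forall>\<^sub>F N in sequentially. finite (Pow {1..N}) \<and> X \<subseteq> Pow {1..N} \<and> Pow {1..N} \<subseteq> {T. finite T \<and> 0 \<notin> T}"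
    using eventually_ge_at_top[of N0]
  proof eventually_elim
    case (elim N)
    show ?case
    proof (intro conjI subsetI)
      show "finite (Pow {1..N})"
        by simp
      show "T \<in> Pow {1..N}" if "T \<in> X" for T
      proof (intro PowI subsetI)
        fix t assume "t \<in> T"
        then have "t \<le> N0"
          using N0 that by blast
        moreover have "t \<noteq> 0"
          using X(3)[OF that] \<open>t \<in> T\<close> by metis
        ultimately show "t \<in> {1..N}"
          using elim by simp
      qed
      show "T \<in> {T. finite T \<and> 0 \<notin> T}" if "T \<in> Pow {1..N}" for T
        using finite_subset[OF PowD[OF that]] subsetD[OF PowD[OF that], of 0] by auto
    qed
  qed
qed

lemma weight_incr_tuple:
  assumes "ts \<in> incr_tuples k"
  shows "weight q (set ts) = q ^ sum_list ts / (\<Prod>t\<leftarrow>ts. (1 - q ^ t)\<^sup>2)"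
proof -
  have "distinct ts"
    using assms by (simp add: incr_tuples_def strict_sorted_iff)
  then have "weight q (set ts) = (\<Prod>t\<leftarrow>ts. q ^ t / (1 - q ^ t)\<^sup>2)"
    unfolding weight_def by (rule prod.distinct_set_conv_list)
  also have "\<dots> = q ^ sum_list ts / (\<Prod>t\<leftarrow>ts. (1 - q ^ t)\<^sup>2)"
    by (induction ts) (auto simp: power_add)
  finally show ?thesis .
qed

text \<open>The double sum over k and over k-tuples is merged into a single sum over finite sets, so
  that the truncations \<open>binom_A_partial\<close> become its partial sums.\<close>

lemma binom_A_sum_has_sum:
  assumes "norm q < 1"
  shows "((\<lambda>T. of_nat (ibinom (2 * card T) (int (card T) + \<alpha>)) * weight q T)
    has_sum binom_A_sum \<alpha> q) {T. finite T \<and> 0 \<notin> T}"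
proof -
  define w where "w ts = q ^ sum_list ts / (\<Prod>t\<leftarrow>ts. (1 - q ^ t)\<^sup>2)" for ts
  define b where "b k = (of_nat (ibinom (2 * k) (int k + \<alpha>)) :: complex)" for k
  obtain M where M: "\<And>k F. finite F \<Longrightarrow> F \<subseteq> incr_tuples k \<Longrightarrow> (\<Sum>ts\<in>F. norm (w ts)) \<le> M / 16 ^ k"
    unfolding w_def using A_summand_bound[OF assms] by blast
  have M0: "M \<ge> 0"
    using M[of "{}" 0] by simp
  have absA: "(\<lambda>ts. norm (w ts)) summable_on incr_tuples k" for k
    unfolding w_def by (rule abs_summable_A[OF assms])
  have A_sum: "(w has_sum A k q) (incr_tuples k)" for k
    using has_sum_infsum[OF abs_summable_summable[OF absA[of k]]] unfolding A_def w_def by simp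
  have b_le: "norm (b k) \<le> 4 ^ k" for k
  proof -
    have "ibinom (2 * k) (int k + \<alpha>) \<le> 2 ^ (2 * k)"
      by (simp add: ibinom_def binomial_le_pow2)
    then have "real (ibinom (2 * k) (int k + \<alpha>)) \<le> real (2 ^ (2 * k))"
      by (rule of_nat_mono)
    then show ?thesis
      by (simp add: b_def power_mult)
  qed
  \<comment> \<open>Absolute convergence of the double sum: the binomial is at most 4^k and the
    tuples of length k contribute at most M / 16^k, leaving a geometric series of ratio 1/4.\<close>
  have "(\<lambda>p. norm (case p of (k, ts) \<Rightarrow> b k * w ts)) summable_on (SIGMA k:UNIV. incr_tuples k)"
    unfolding Infinite_Sum.abs_summable_on_Sigma_iff
  proof (intro conjI ballI)
    show "(\<lambda>ts. norm (case (k, ts) of (k, ts) \<Rightarrow> b k * w ts)) summable_on incr_tuples k" for k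
      by (simp add: norm_mult absA summable_on_cmult_right)
    show "(\<lambda>k. norm (\<Sum>\<^sub>\<infinity>ts\<in>incr_tuples k. norm (case (k, ts) of (k, ts) \<Rightarrow> b k * w ts))) summable_on UNIV"
    proof (rule Infinite_Sum.abs_summable_on_comparison_test'[OF summable_on_quarter])
      fix k
      have "(\<Sum>\<^sub>\<infinity>ts\<in>incr_tuples k. norm (w ts)) \<le> M / 16 ^ k"
        by (intro infsum_le_finite_sums absA M)
      moreover have "(\<Sum>\<^sub>\<infinity>ts\<in>incr_tuples k. norm (w ts)) \<ge> 0"
        by (intro infsum_nonneg) auto
      ultimately have "norm (b k) * (\<Sum>\<^sub>\<infinity>ts\<in>incr_tuples k. norm (w ts)) \<le> 4 ^ k * (M / 16 ^ k)"
        using b_le by (intro mult_mono) auto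
      also have "(16::real) ^ k = 4 ^ k * 4 ^ k"
        by (simp flip: power_mult_distrib)
      finally have "norm (b k) * (\<Sum>\<^sub>\<infinity>ts\<in>incr_tuples k. norm (w ts)) \<le> M * (1 / 4) ^ k"
        by (simp add: power_divide)
      moreover have "(\<Sum>\<^sub>\<infinity>ts\<in>incr_tuples k. norm (case (k, ts) of (k, ts) \<Rightarrow> b k * w ts))
          = norm (b k) * (\<Sum>\<^sub>\<infinity>ts\<in>incr_tuples k. norm (w ts))"
        by (simp add: norm_mult infsum_cmult_right')
      ultimately show "norm (\<Sum>\<^sub>\<infinity>ts\<in>incr_tuples k. norm (case (k, ts) of (k, ts) \<Rightarrow> b k * w ts)) \<le> M * (1 / 4) ^ k"
        using \<open>(\<Sum>\<^sub>\<infinity>ts\<in>incr_tuples k. norm (w ts)) \<ge> 0\<close> by (simp add: abs_mult)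
    qed
  qed
  then have "(\<lambda>(k, ts). b k * w ts) summable_on (SIGMA k:UNIV. incr_tuples k)"
    by (rule abs_summable_summable)
  then obtain s where s: "((\<lambda>(k, ts). b k * w ts) has_sum s) (SIGMA k:UNIV. incr_tuples k)"
    unfolding summable_on_def by blast
  have "((\<lambda>k. b k * A k q) has_sum s) UNIV"
    using has_sum_Sigma'[OF s] has_sum_cmult_right[OF A_sum] by simp
  \<comment> \<open>For k < |\<alpha>| the lower index k + \<alpha> is negative or exceeds 2k, so
    these terms are 0.\<close>
  then have "((\<lambda>k. of_nat ((2 * k) choose nat (int k + \<alpha>)) * A k q) has_sum s) {nat \<bar>\<alpha>\<bar>..}"
    by (subst (asm) has_sum_cong_neutral[where T = "{nat \<bar>\<alpha>\<bar>..}"]) (auto simp: b_def ibinom_def)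
  then have "s = binom_A_sum \<alpha> q"
    unfolding binom_A_sum_def by (rule infsumI[symmetric])
  define j where "j T = (card T, sorted_list_of_set T)" for T :: "nat set"
  have j: "j T \<in> (SIGMA k:UNIV. incr_tuples k)" if "finite T" "0 \<notin> T" for T
  proof -
    have "t \<noteq> 0" if "t \<in> T" for t
      using that \<open>0 \<notin> T\<close> by metis
    then show ?thesis
      using that by (simp add: j_def incr_tuples_def)
  qed
  have "bij_betw j {T. finite T \<and> 0 \<notin> T} (SIGMA k:UNIV. incr_tuples k)"
  proof (rule bij_betwI')
    show "j T = j U \<longleftrightarrow> T = U" if "T \<in> {T. finite T \<and> 0 \<notin> T}" "U \<in> {T. finite T \<and> 0 \<notin> T}" for T U
      using that unfolding j_def by (metis mem_Collect_eq prod.inject sorted_list_of_set.set_sorted_key_list_of_set)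
    show "j T \<in> (SIGMA k:UNIV. incr_tuples k)" if "T \<in> {T. finite T \<and> 0 \<notin> T}" for T
      using that j by blast
    show "\<exists>T\<in>{T. finite T \<and> 0 \<notin> T}. p = j T" if p: "p \<in> (SIGMA k:UNIV. incr_tuples k)" for p
    proof -
      obtain k ts where ts: "p = (k, ts)" "length ts = k" "sorted_wrt (<) ts" "\<forall>t\<in>set ts. 0 < t"
        using p by (auto simp: incr_tuples_def)
      then have "distinct ts" "sorted ts"
        by (auto simp: strict_sorted_iff)
      then have "p = j (set ts)"
        using ts by (simp add: j_def distinct_card sorted_list_of_set.idem_if_sorted_distinct)
      moreover have "0 \<notin> set ts"
        using ts(4) by blast
      ultimately show ?thesis
        by blast
    qed
  qed
  then have "((\<lambda>T. (\<lambda>(k, ts). b k * w ts) (j T)) has_sum s) {T. finite T \<and> 0 \<notin> T}"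
    using s has_sum_reindex_bij_betw by blast
  moreover have "(\<lambda>(k, ts). b k * w ts) (j T)
      = of_nat (ibinom (2 * card T) (int (card T) + \<alpha>)) * weight q T"
    if "T \<in> {T. finite T \<and> 0 \<notin> T}" for T
  proof -
    have "sorted_list_of_set T \<in> incr_tuples (card T)"
      using that j[of T] by (simp add: j_def)
    from weight_incr_tuple[OF this, of q] that show ?thesis
      by (simp add: b_def w_def j_def)
  qed
  ultimately show ?thesis
    unfolding \<open>s = binom_A_sum \<alpha> q\<close> by (rule has_sum_cong[THEN iffD1, rotated])
qed

lemma binom_A_partial_tendsto:
  assumes "norm q < 1"
  shows "(\<lambda>N. binom_A_partial q N \<alpha>) \<longlonglongrightarrow> binom_A_sum \<alpha> q"
  using filterlim_compose[OF binom_A_sum_has_sum[OF assms, unfolded has_sum_def] filterlim_Pow_atLeastAtMost]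
  unfolding binom_A_partial_def .

text \<open>Limit of the finite identity: \<open>jtp_coeff\<close> contributes one factor 1 /
  (q;q)_inf, the squared q-factorial two more.\<close>

lemma binom_A_sum_pair:
  assumes "norm q < 1" "q \<noteq> 0"
  shows "binom_A_sum \<alpha> q + binom_A_sum (\<alpha> - 1) q = theta_coeff q \<alpha> / qpoch_inf q q ^ 3"
proof (rule LIMSEQ_unique)
  show "(\<lambda>N. jtp_coeff q N \<alpha> / (qfact q N)\<^sup>2) \<longlonglongrightarrow> binom_A_sum \<alpha> q + binom_A_sum (\<alpha> - 1) q"
    unfolding binom_A_partial_pair[OF assms, symmetric]
    by (intro tendsto_add binom_A_partial_tendsto assms)
  have "(\<lambda>N. jtp_coeff q N \<alpha> / (qfact q N)\<^sup>2) \<longlonglongrightarrow> theta_coeff q \<alpha> / qpoch_inf q q / (qpoch_inf q q)\<^sup>2"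
    using qpoch_inf_nz[OF assms(1)] by (intro tendsto_intros jtp_coeff_tendsto qfact_tendsto assms) auto
  then show "(\<lambda>N. jtp_coeff q N \<alpha> / (qfact q N)\<^sup>2) \<longlonglongrightarrow> theta_coeff q \<alpha> / qpoch_inf q q ^ 3"
    by (simp add: power2_eq_square power3_eq_cube mult.assoc)
qed

section \<open>The Jacobi triple product\<close>

text \<open>Tannery's theorem for series, carried over to unordered sums over the integers by the
  enumeration \<open>int_decode\<close>.\<close>

lemma has_sum_int_dominated:
  fixes f :: "nat \<Rightarrow> int \<Rightarrow> complex"
  assumes "\<And>N. (f N has_sum s N) UNIV" "\<And>k. (\<lambda>N. f N k) \<longlonglongrightarrow> g k" "\<And>N k. norm (f N k) \<le> h k"
    and "h summable_on UNIV" "s \<longlonglongrightarrow> L"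
  shows "(g has_sum L) UNIV"
proof -
  have bij: "bij_betw int_decode UNIV UNIV"
    by (rule bij_int_decode)
  have "(\<lambda>k. h (int_decode k)) summable_on UNIV"
    using assms(4) summable_on_reindex_bij_betw[OF bij] by blast
  then have h: "summable (\<lambda>k. h (int_decode k))"
    by (rule summable_on_imp_summable)
  have "eventually (\<lambda>N. summable (\<lambda>k. norm (f N (int_decode k)))) sequentially \<and>
     summable (\<lambda>k. norm (g (int_decode k))) \<and>
     (\<lambda>N. \<Sum>k. f N (int_decode k)) \<longlonglongrightarrow> (\<Sum>k. g (int_decode k))"
    by (rule tannerys_theorem[where M = "\<lambda>k. h (int_decode k)"])
      (use assms h in \<open>auto simp: always_eventually\<close>)
  moreover have "(\<lambda>N. \<Sum>k. f N (int_decode k)) = s"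
  proof
    fix N
    have "((\<lambda>k. f N (int_decode k)) has_sum s N) UNIV"
      using assms(1) has_sum_reindex_bij_betw[OF bij] by blast
    then show "(\<Sum>k. f N (int_decode k)) = s N"
      by (intro sums_unique[symmetric] has_sum_imp_sums)
  qed
  ultimately have g: "summable (\<lambda>k. norm (g (int_decode k)))" "s \<longlonglongrightarrow> (\<Sum>k. g (int_decode k))"
    by auto
  have "((\<lambda>k. g (int_decode k)) has_sum (\<Sum>k. g (int_decode k))) UNIV"
    by (rule norm_summable_imp_has_sum[OF g(1) summable_sums[OF summable_norm_cancel[OF g(1)]]])
  then show ?thesis
    using LIMSEQ_unique[OF g(2) assms(5)] has_sum_reindex_bij_betw[OF bij] by metis
qed

text \<open>The quotient of consecutive terms is r^n w, which tends to 0 however large w is.\<close>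

lemma summable_triangular:
  fixes r w :: real
  assumes "0 < r" "r < 1" "0 < w"
  shows "summable (\<lambda>n. r ^ (n * (n - 1) div 2) * w ^ n)"
proof -
  have "(\<lambda>n. r ^ n * w) \<longlonglongrightarrow> 0 * w"
    using assms by (intro tendsto_mult LIMSEQ_power_zero tendsto_const) auto
  then have "eventually (\<lambda>n. r ^ n * w < 1 / 2) sequentially"
    by (intro order_tendstoD(2)) auto
  then obtain N where N: "\<And>n. n \<ge> N \<Longrightarrow> r ^ n * w < 1 / 2"
    unfolding eventually_sequentially by blast
  show ?thesis
  proof (rule summable_ratio_test[where c = "1 / 2" and N = N])
    fix n assume n: "N \<le> n"
    have "Suc n * (Suc n - 1) = n * (n - 1) + 2 * n"
      by (cases n) (auto simp: algebra_simps)
    then have e: "Suc n * (Suc n - 1) div 2 = n * (n - 1) div 2 + n"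
      by simp
    have "r ^ (Suc n * (Suc n - 1) div 2) * w ^ Suc n = (r ^ n * w) * (r ^ (n * (n - 1) div 2) * w ^ n)"
      unfolding e by (simp add: power_add)
    also have "\<dots> \<le> 1 / 2 * (r ^ (n * (n - 1) div 2) * w ^ n)"
      using N[OF n] assms by (intro mult_right_mono) auto
    finally show "norm (r ^ (Suc n * (Suc n - 1) div 2) * w ^ Suc n) \<le>
        1 / 2 * norm (r ^ (n * (n - 1) div 2) * w ^ n)"
      using assms by (simp add: abs_mult)
  qed simp
qed

lemma abs_summable_theta:
  fixes q z :: complex
  assumes "norm q < 1" "q \<noteq> 0" "z \<noteq> 0"
  shows "(\<lambda>n. norm (theta_coeff q n * z powi n)) summable_on UNIV"
proof -
  define r w where "r = norm q" and "w = norm z"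
  have rw: "0 < r" "r < 1" "0 < w"
    using assms by (auto simp: r_def w_def)
  define f where "f n = norm (theta_coeff q n * z powi n)" for n
  have f: "f n = r powi (n * (n - 1) div 2) * w powi n" for n
    by (simp add: f_def theta_coeff_def norm_mult norm_power_int r_def w_def)
  have pos: "f (int n) = r ^ (n * (n - 1) div 2) * w ^ n" for n
  proof -
    have "int n * (int n - 1) = int (n * (n - 1))"
      by (cases n) (auto simp: algebra_simps)
    also have "\<dots> div 2 = int (n * (n - 1) div 2)"
      by (simp add: zdiv_int)
    finally show ?thesis
      by (simp only: f power_int_of_nat)
  qed
  \<comment> \<open>At -n the exponent is n(n-1)/2 + n; the extra r^n turns 1/w into r/w, so the
    negative half is a series of the same shape.\<close>
  have neg: "f (- int n) = r ^ (n * (n - 1) div 2) * (r / w) ^ n" for n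
  proof -
    have "- int n * (- int n - 1) = int (n * (n - 1) + 2 * n)"
      by (cases n) (auto simp: algebra_simps)
    also have "\<dots> div 2 = int (n * (n - 1) div 2 + n)"
      by (simp add: zdiv_int)
    finally show ?thesis
      unfolding f by (simp only: power_int_of_nat) (simp add: power_add power_divide power_int_minus field_simps)
  qed
  have sum: "(\<lambda>n::nat. r ^ (n * (n - 1) div 2) * w ^ n) summable_on UNIV" if "0 < w" for w
    using summable_triangular[OF rw(1,2) that] rw that
    by (intro norm_summable_imp_summable_on) (simp add: abs_mult)
  have "f summable_on ({0..} \<union> {..0})"
  proof (rule summable_on_union)
    show "f summable_on {0..}"
      using sum[OF rw(3)]
      by (subst summable_on_reindex_bij_witness[of _ int nat UNIV "\<lambda>n. f (int n)"]) (auto simp: pos)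
    show "f summable_on {..0}"
      using sum[of "r / w"] rw
      by (subst summable_on_reindex_bij_witness[of _ "\<lambda>k. - int k" "\<lambda>\<beta>. nat (- \<beta>)" UNIV
            "\<lambda>n. f (- int n)"]) (auto simp: neg)
  qed
  also have "{0..} \<union> {..0} = (UNIV :: int set)"
    by auto
  finally show ?thesis
    by (simp add: f_def[abs_def])
qed

lemma has_sum_int_shift:
  fixes f :: "int \<Rightarrow> 'a :: {comm_monoid_add, topological_space}"
  shows "((\<lambda>n. f (n + c)) has_sum s) UNIV \<longleftrightarrow> (f has_sum s) UNIV"
  by (rule has_sum_reindex_bij_witness[of _ "\<lambda>n. n - c" "\<lambda>n. n + c"]) auto

text \<open>The step from N to N + 1 multiplies the product by (1 + z y)(1 + y/z) = 1 + y^2 + y (z +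
  1/z) with y = q^(N+1), which on coefficients is \<open>jtp_coeff_Suc\<close>. Summing over all
  integers lets the index shifts pass without tracking the support.\<close>

lemma finite_jtp:
  fixes q z :: complex
  assumes "norm q < 1" "q \<noteq> 0" "z \<noteq> 0"
  shows "((\<lambda>n. jtp_coeff q N n * z powi n) has_sum
    (\<Prod>j<Suc N. 1 + z * q ^ j) * (\<Prod>j<N. 1 + q ^ Suc j / z)) UNIV"
proof (induction N)
  case 0
  have "((\<lambda>n. jtp_coeff q 0 n * z powi n) has_sum (\<Sum>n\<in>{0,1}. jtp_coeff q 0 n * z powi n)) UNIV"
    using assms by (intro has_sum_finite_neutralI[where A = UNIV and B = "{0, 1}"]) (auto simp: jtp_coeff_0)
  then show ?case
    using assms by (simp add: jtp_coeff_0)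
next
  case (Suc N)
  define y F where "y = q ^ Suc N" and "F = (\<Prod>j<Suc N. 1 + z * q ^ j) * (\<Prod>j<N. 1 + q ^ Suc j / z)"
  define f where "f n = jtp_coeff q N n * z powi n" for n
  have f: "(f has_sum F) UNIV"
    unfolding f_def F_def by (rule Suc.IH)
  have "((\<lambda>n. (1 + y\<^sup>2) * f n + ((y / z) * f (n + 1) + (y * z) * f (n + (-1)))) has_sum
     (1 + y\<^sup>2) * F + ((y / z) * F + (y * z) * F)) UNIV"
    by (intro has_sum_add has_sum_cmult_right f f[THEN has_sum_int_shift[THEN iffD2]])
  moreover have "(1 + y\<^sup>2) * f n + ((y / z) * f (n + 1) + (y * z) * f (n + (-1))) = jtp_coeff q (Suc N) n * z powi n" for n
  proof -
    have *: "q ^ (2 * Suc N) = y\<^sup>2"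
      unfolding y_def by (metis mult.commute power_mult)
    have "(y / z) * f (n + 1) = y * jtp_coeff q N (n + 1) * z powi n"
      using assms(3) by (simp add: f_def power_int_add)
    moreover have "(y * z) * f (n + (-1)) = y * jtp_coeff q N (n - 1) * z powi n"
      using assms(3) by (simp add: f_def power_int_diff)
    ultimately show ?thesis
      unfolding jtp_coeff_Suc[OF assms(1,2)] * y_def[symmetric]
      by (simp add: f_def algebra_simps)
  qed
  moreover have "(1 + y\<^sup>2) * F + ((y / z) * F + (y * z) * F) = F * (1 + z * y) * (1 + y / z)"
    using assms(3) by (simp add: field_simps power2_eq_square)
  ultimately show ?case
    by (simp add: F_def y_def mult_ac)
qed

text \<open>Dominated convergence in the finite version gives the series divided by (q;q)_inf; the
  last step clears this denominator.\<close>

theorem jacobi_triple_product: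
  fixes q z :: complex
  assumes "norm q < 1" "q \<noteq> 0" "z \<noteq> 0"
  shows "((\<lambda>n. theta_coeff q n * z powi n) has_sum
    qpoch_inf (- z) q * qpoch_inf (- (q / z)) q * qpoch_inf q q) UNIV"
proof -
  obtain K where K: "K \<ge> 0" "\<And>N \<alpha>. norm (jtp_coeff q N \<alpha>) \<le> K * norm (theta_coeff q \<alpha>)"
    using jtp_coeff_bound[OF assms(1)] by blast
  have lim: "(\<lambda>N. \<Prod>j<N. 1 + a * q ^ j) \<longlonglongrightarrow> qpoch_inf (- a) q" for a
    using convergent_prod_LIMSEQ[OF convergent_prod_qpoch_inf[OF assms(1)], of "- a"]
    unfolding LIMSEQ_lessThan_iff_atMost[symmetric] by (simp add: qpoch_inf_def)
  have "((\<lambda>n. theta_coeff q n / qpoch_inf q q * z powi n) has_sum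
    qpoch_inf (- z) q * qpoch_inf (- (q / z)) q) UNIV"
  proof (rule has_sum_int_dominated[OF finite_jtp[OF assms]])
    show "(\<lambda>N. jtp_coeff q N k * z powi k) \<longlonglongrightarrow> theta_coeff q k / qpoch_inf q q * z powi k" for k
      by (intro tendsto_intros jtp_coeff_tendsto assms)
    show "norm (jtp_coeff q N k * z powi k) \<le> K * norm (theta_coeff q k * z powi k)" for N k
      using mult_right_mono[OF K(2)[of N k], of "norm (z powi k)"] by (simp add: norm_mult mult.assoc)
    show "(\<lambda>k. K * norm (theta_coeff q k * z powi k)) summable_on UNIV"
      by (intro summable_on_cmult_right abs_summable_theta assms)
    show "(\<lambda>N. (\<Prod>j<Suc N. 1 + z * q ^ j) * (\<Prod>j<N. 1 + q ^ Suc j / z))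
        \<longlonglongrightarrow> qpoch_inf (- z) q * qpoch_inf (- (q / z)) q"
      using tendsto_mult[OF LIMSEQ_Suc[OF lim[of z]] lim[of "q / z"]] by simp
  qed
  from has_sum_cmult_left[OF this, of "qpoch_inf q q"] show ?thesis
    using qpoch_inf_nz[OF assms(1)] by (simp add: field_simps)
qed

section \<open>Products modulo 5 and the four-term combination of \<open>S\<close>\<close>

lemma prodinf_residue_pair:
  fixes q :: complex
  assumes "norm q < 1"
  shows "(\<Prod>n. 1 / ((1 - q ^ (5 * n + a)) * (1 - q ^ (5 * n + b)))) =
    1 / (qpoch_inf (q ^ a) (q ^ 5) * qpoch_inf (q ^ b) (q ^ 5))"
proof -
  have q5: "norm (q ^ 5) < 1"
    using assms by (simp add: norm_power power_less_one_iff)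
  have e: "1 - q ^ (5 * n + c) = 1 - q ^ c * (q ^ 5) ^ n" for n c
    by (simp only: power_add power_mult[of q 5 n] mult.commute[of "q ^ c"])
  have "(\<Prod>n. 1 / ((1 - q ^ (5 * n + a)) * (1 - q ^ (5 * n + b)))) =
      (\<Prod>n. inverse ((1 - q ^ a * (q ^ 5) ^ n) * (1 - q ^ b * (q ^ 5) ^ n)))"
    by (simp only: e inverse_eq_divide)
  also have "\<dots> = inverse (\<Prod>n. (1 - q ^ a * (q ^ 5) ^ n) * (1 - q ^ b * (q ^ 5) ^ n))"
    by (intro prodinf_inverse convergent_prod_mult convergent_prod_qpoch_inf q5)
  also have "(\<Prod>n. (1 - q ^ a * (q ^ 5) ^ n) * (1 - q ^ b * (q ^ 5) ^ n)) =
      qpoch_inf (q ^ a) (q ^ 5) * qpoch_inf (q ^ b) (q ^ 5)"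
    unfolding qpoch_inf_def
    by (intro prodinf_mult[symmetric] convergent_prod_qpoch_inf q5)
  finally show ?thesis
    by (simp only: inverse_eq_divide)
qed

lemma S_has_sum:
  assumes "norm q < 1"
  shows "((\<lambda>\<beta>. (-1) powi \<beta> * binom_A_sum (\<gamma> - 2 * \<beta>) q * binom_A_sum \<beta> q) has_sum S \<gamma> q) UNIV"
proof -
  have "((\<lambda>(\<alpha>, \<beta>). (-1) powi \<beta> * binom_A_sum \<alpha> q * binom_A_sum \<beta> q) has_sum S \<gamma> q)
      {(\<alpha>, \<beta>). \<alpha> + 2 * \<beta> = \<gamma>}"
    unfolding S_def using abs_summable_S[OF assms, of \<gamma>]
    by (intro has_sum_infsum, intro abs_summable_summable[of "\<lambda>(\<alpha>, \<beta>). (-1) powi \<beta> * binom_A_sum \<alpha> q * binom_A_sum \<beta> q"])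
      (simp add: case_prod_unfold)
  also have "?this \<longleftrightarrow> ?thesis"
    by (rule has_sum_reindex_bij_witness[where j = snd and i = "\<lambda>\<beta>. (\<gamma> - 2 * \<beta>, \<beta>)"]) auto
  finally show ?thesis .
qed

text \<open>Each theta coefficient is \<open>P ^ 3\<close> times a pair sum of \<open>B\<close>, so
  a summand expands into four products. Those with \<open>B \<beta>\<close> give
  \<open>S \<gamma>\<close> and \<open>S (\<gamma> - 1)\<close>. Those with
  \<open>B (\<beta> - 1)\<close>, after a shift of \<beta> by one that flips the sign, give
  \<open>- S (\<gamma> - 2)\<close> and \<open>- S (\<gamma> - 3)\<close>.\<close>

lemma S_combination_has_sum:
  assumes "norm q < 1" "q \<noteq> 0"
  shows "((\<lambda>\<beta>. (-1) powi \<beta> * theta_coeff q \<beta> * theta_coeff q (\<gamma> - 2 * \<beta>)) has_sum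
    qpoch_inf q q ^ 6 * (S \<gamma> q + S (\<gamma> - 1) q - S (\<gamma> - 2) q - S (\<gamma> - 3) q)) UNIV"
proof -
  define B where "B \<alpha> = binom_A_sum \<alpha> q" for \<alpha>
  define P where "P = qpoch_inf q q"
  have P: "P \<noteq> 0"
    unfolding P_def by (rule qpoch_inf_nz[OF assms(1)])
  have \<theta>: "theta_coeff q \<alpha> = P ^ 3 * (B \<alpha> + B (\<alpha> - 1))" for \<alpha>
    using binom_A_sum_pair[OF assms, of \<alpha>] P by (simp add: B_def P_def)
  define g where "g \<gamma> \<beta> = (-1) powi \<beta> * B (\<gamma> - 2 * \<beta>) * B \<beta>" for \<gamma> \<beta>
  have g: "(g \<gamma> has_sum S \<gamma> q) UNIV" for \<gamma>
    unfolding g_def B_def by (rule S_has_sum[OF assms(1)])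
  have "((\<lambda>\<beta>. P ^ 6 * (g \<gamma> \<beta> + g (\<gamma> - 1) \<beta> + (- g (\<gamma> - 2) (\<beta> + (-1)) + - g (\<gamma> - 3) (\<beta> + (-1))))) has_sum
     P ^ 6 * (S \<gamma> q + S (\<gamma> - 1) q + (- S (\<gamma> - 2) q + - S (\<gamma> - 3) q))) UNIV"
    by (intro has_sum_cmult_right has_sum_add has_sum_uminusI g g[THEN has_sum_int_shift[THEN iffD2]])
  moreover have "P ^ 6 * (g \<gamma> \<beta> + g (\<gamma> - 1) \<beta> + (- g (\<gamma> - 2) (\<beta> + (-1)) + - g (\<gamma> - 3) (\<beta> + (-1)))) =
      (-1) powi \<beta> * theta_coeff q \<beta> * theta_coeff q (\<gamma> - 2 * \<beta>)" for \<beta>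
  proof -
    have e: "\<gamma> - 2 - 2 * (\<beta> + (-1)) = \<gamma> - 2 * \<beta>" "\<gamma> - 3 - 2 * (\<beta> + (-1)) = \<gamma> - 2 * \<beta> - 1"
      "\<gamma> - 1 - 2 * \<beta> = \<gamma> - 2 * \<beta> - 1" "\<beta> + (-1) = \<beta> - 1"
      by auto
    have s: "(-1 :: complex) powi (\<beta> - 1) = - ((-1) powi \<beta>)"
      by (simp add: power_int_diff)
    show ?thesis
      unfolding g_def e s \<theta> by (simp add: algebra_simps flip: power_add)
  qed
  moreover have "x + y + (- z + - w) = x + y - z - w" for x y z w :: complex
    by simp
  ultimately show ?thesis
    by (simp only: P_def)
qed

text \<open>Hypothesis \<open>e\<close> is the completed square: with \<beta> = c + 2n the exponent
  is a constant \<open>E\<close> plus that of the theta series in base q^5 at z = -q^a. The shift is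
  even, so the sign stays (-1)^c. Of the three products from the triple product, (q^5;q^5)_inf joins
  \<open>P ^ 6\<close> to form \<open>F5 q\<close>.\<close>

lemma S_combination:
  assumes "norm q < 1" "q \<noteq> 0" "a < 5"
    and e: "\<And>c. (c + 2 * n) * (c + 2 * n - 1) div 2 +
      (\<gamma> - 2 * (c + 2 * n)) * (\<gamma> - 2 * (c + 2 * n) - 1) div 2 =
      E + (5 * (c * (c - 1) div 2) + int a * c)"
  shows "qpoch_inf (q ^ a) (q ^ 5) * qpoch_inf (q ^ (5 - a)) (q ^ 5) / F5 q =
    q powi (- E) * (S \<gamma> q + S (\<gamma> - 1) q - S (\<gamma> - 2) q - S (\<gamma> - 3) q)"
proof -
  define P s where "P = qpoch_inf q q" and "s = S \<gamma> q + S (\<gamma> - 1) q - S (\<gamma> - 2) q - S (\<gamma> - 3) q"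
  have P: "P \<noteq> 0"
    unfolding P_def by (rule qpoch_inf_nz[OF assms(1)])
  have "((\<lambda>c. (-1) powi (c + 2 * n) * theta_coeff q (c + 2 * n) * theta_coeff q (\<gamma> - 2 * (c + 2 * n)))
      has_sum P ^ 6 * s) UNIV"
    unfolding P_def s_def by (rule S_combination_has_sum[OF assms(1,2), THEN has_sum_int_shift[THEN iffD2]])
  moreover have "(-1) powi (c + 2 * n) * theta_coeff q (c + 2 * n) * theta_coeff q (\<gamma> - 2 * (c + 2 * n)) =
      q powi E * (theta_coeff (q ^ 5) c * (- (q ^ a)) powi c)" for c
  proof -
    have "theta_coeff q (c + 2 * n) * theta_coeff q (\<gamma> - 2 * (c + 2 * n)) =
        q powi E * (q powi (5 * (c * (c - 1) div 2)) * q powi (int a * c))"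
      unfolding theta_coeff_def
      by (simp only: e flip: power_int_add[OF disjI1[OF assms(2)]])
    moreover have "theta_coeff (q ^ 5) c = q powi (5 * (c * (c - 1) div 2))"
      unfolding theta_coeff_def power_int_mult[of q 5] by simp
    moreover have "(- (q ^ a)) powi c = (-1) powi c * q powi (int a * c)"
    proof -
      have "(- (q ^ a)) powi c = (-1 * q ^ a) powi c"
        by simp
      then show ?thesis
        by (simp only: power_int_mult_distrib power_int_mult power_int_of_nat)
    qed
    moreover have "(-1 :: complex) powi (c + 2 * n) = (-1) powi c"
    proof -
      have "(-1 :: complex) powi (2 * n) = 1"
        using power_int_mult[of "-1 :: complex" 2 n] by simp
      then show ?thesis
        by (simp add: power_int_add)
    qed
    ultimately show ?thesis
      by (simp only: mult.assoc) (simp only: mult.left_commute)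
  qed
  ultimately have "((\<lambda>c. q powi E * (theta_coeff (q ^ 5) c * (- (q ^ a)) powi c)) has_sum P ^ 6 * s) UNIV"
    by simp
  moreover have "((\<lambda>c. theta_coeff (q ^ 5) c * (- (q ^ a)) powi c) has_sum
      qpoch_inf (q ^ a) (q ^ 5) * qpoch_inf (q ^ (5 - a)) (q ^ 5) * qpoch_inf (q ^ 5) (q ^ 5)) UNIV"
  proof -
    have "q ^ 5 / q ^ a = q ^ (5 - a)"
      using assms(2,3) by (simp add: power_diff)
    moreover have "norm (q ^ 5) < 1"
      using assms by (simp add: norm_power power_less_one_iff)
    ultimately show ?thesis
      using jacobi_triple_product[of "q ^ 5" "- (q ^ a)"] assms(2) by simp
  qed
  ultimately have "P ^ 6 * s = q powi E *
      (qpoch_inf (q ^ a) (q ^ 5) * qpoch_inf (q ^ (5 - a)) (q ^ 5) * qpoch_inf (q ^ 5) (q ^ 5))"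
    by (rule has_sum_unique[OF _ has_sum_cmult_right])
  then have s: "s = q powi E *
      (qpoch_inf (q ^ a) (q ^ 5) * qpoch_inf (q ^ (5 - a)) (q ^ 5) * qpoch_inf (q ^ 5) (q ^ 5)) / P ^ 6"
    using P by (simp add: eq_divide_eq mult.commute)
  have "q powi (- E) * q powi E = 1"
    using assms(2) by (simp add: power_int_minus)
  then have "q powi (- E) * s =
      qpoch_inf (q ^ a) (q ^ 5) * qpoch_inf (q ^ (5 - a)) (q ^ 5) * qpoch_inf (q ^ 5) (q ^ 5) / P ^ 6"
    unfolding s times_divide_eq_right mult.assoc[symmetric, of "q powi (- E)"] by simp
  then show ?thesis
    unfolding F5_def P_def[symmetric] s_def[symmetric] by simp
qed

theorem theorem1p3:
  fixes q :: complex and n :: int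
  assumes "0 < norm q" and "norm q < 1"
  shows "(1 / (R14 q * F5 q) =
        q powi (- ((5 * n\<^sup>2 - n) div 2)) *
          (S (5 * n + 1) q + S (5 * n) q - S (5 * n - 1) q - S (5 * n - 2) q)) \<and>
      (1 / (R23 q * F5 q) =
        q powi (- ((5 * n\<^sup>2 - 3 * n) div 2)) *
          (S (5 * n) q + S (5 * n - 1) q - S (5 * n - 2) q - S (5 * n - 3) q))"
proof
  have q: "q \<noteq> 0"
    using assms(1) by auto
  \<comment> \<open>All the halved numbers are even, so the exponent identity \<open>e\<close>
    reduces to a polynomial identity over the integers.\<close>
  have half: "x div 2 + y div 2 = z div 2 + (5 * (w div 2) + v)"
    if "even x" "even y" "even z" "even w" "x + y = z + 5 * w + 2 * v" for x y z w v :: int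
    using that by (auto elim!: evenE)
  \<comment> \<open>Here \<alpha> = n + 1 - 2c. The mixed terms in n and c cancel, and the part in c
    is (5c^2 - 3c)/2, so a = 1 and the residues are 1 and 4.\<close>
  have "qpoch_inf (q ^ 1) (q ^ 5) * qpoch_inf (q ^ (5 - 1)) (q ^ 5) / F5 q =
    q powi (- ((5 * n\<^sup>2 - n) div 2)) *
      (S (5 * n + 1) q + S (5 * n + 1 - 1) q - S (5 * n + 1 - 2) q - S (5 * n + 1 - 3) q)"
    by (rule S_combination[OF assms(2) q, where n = n], simp, rule half) (auto simp: algebra_simps power2_eq_square)
  then show "1 / (R14 q * F5 q) = q powi (- ((5 * n\<^sup>2 - n) div 2)) *
      (S (5 * n + 1) q + S (5 * n) q - S (5 * n - 1) q - S (5 * n - 2) q)"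
    unfolding R14_def prodinf_residue_pair[OF assms(2)] by simp
  \<comment> \<open>Here \<alpha> = n - 2c. The part in c is (5c^2 + c)/2, so a = 3 and the residues
    are 3 and 2.\<close>
  have "qpoch_inf (q ^ 3) (q ^ 5) * qpoch_inf (q ^ (5 - 3)) (q ^ 5) / F5 q =
    q powi (- ((5 * n\<^sup>2 - 3 * n) div 2)) *
      (S (5 * n) q + S (5 * n - 1) q - S (5 * n - 2) q - S (5 * n - 3) q)"
    by (rule S_combination[OF assms(2) q, where n = n], simp, rule half) (auto simp: algebra_simps power2_eq_square)
  then show "1 / (R23 q * F5 q) = q powi (- ((5 * n\<^sup>2 - 3 * n) div 2)) *
      (S (5 * n) q + S (5 * n - 1) q - S (5 * n - 2) q - S (5 * n - 3) q)"
    unfolding R23_def prodinf_residue_pair[OF assms(2)] by (simp add: mult_ac)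
qed

end
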